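(* Let $(a_i)$ be a computable increasing sequence of rational numbers converging to a real $\alpha$. Then $\alpha$ is not Martin-Löf random if and only if there exists a computable sequence $h_0,h_1,\dots$ of non-negative rational numbers such that $\sum_i h_i<\infty$ and $\alpha\le a_i+h_i$ for infinitely many $i$. *)

theory Defs
  imports "HOL-Analysis.Analysis"
begin

text \<open>Codes of partial recursive functions with their big-step semantics: \<open>rec_eval f xs y\<close> says
  that the function coded by \<open>f\<close> halts on the argument list \<open>xs\<close> with value \<open>y\<close>.\<close>

datatype recf =
    RZero
  | RSucc
  | RProj nat
  | RComp recf "recf list"
  | RPrim recf recf
  | RMin recf

inductive rec_eval :: "recf \<Rightarrow> nat list \<Rightarrow> nat \<Rightarrow> bool" where
  zero: "rec_eval RZero xs 0"
| succ: "rec_eval RSucc [x] (Suc x)"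
| proj: "i < length xs \<Longrightarrow> rec_eval (RProj i) xs (xs ! i)"
| comp: "list_all2 (\<lambda>g y. rec_eval g xs y) gs ys \<Longrightarrow> rec_eval f ys z
    \<Longrightarrow> rec_eval (RComp f gs) xs z"
| prim_0: "rec_eval f xs y \<Longrightarrow> rec_eval (RPrim f g) (0 # xs) y"
| prim_Suc: "rec_eval (RPrim f g) (n # xs) y \<Longrightarrow> rec_eval g (n # y # xs) z
    \<Longrightarrow> rec_eval (RPrim f g) (Suc n # xs) z"
| min: "(\<And>m. m < n \<Longrightarrow> \<exists>y. rec_eval f (m # xs) (Suc y)) \<Longrightarrow> rec_eval f (n # xs) 0
    \<Longrightarrow> rec_eval (RMin f) xs n"

text \<open>Functions of arity \<open>k\<close> are represented on lists; values on lists of other lengths are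
  irrelevant.\<close>

definition computable_fun :: "nat \<Rightarrow> (nat list \<Rightarrow> nat) \<Rightarrow> bool" where
  "computable_fun k f \<longleftrightarrow> (\<exists>r. \<forall>xs. length xs = k \<longrightarrow> rec_eval r xs (f xs))"

definition computable_rat_fun :: "nat \<Rightarrow> (nat list \<Rightarrow> rat) \<Rightarrow> bool" where
  "computable_rat_fun k q \<longleftrightarrow>
    (\<exists>s n d. computable_fun k s \<and> computable_fun k n \<and> computable_fun k d \<and>
      (\<forall>xs. length xs = k \<longrightarrow>
        d xs \<noteq> 0 \<and> q xs = (- 1) ^ s xs * (of_nat (n xs) / of_nat (d xs))))"

definition computable_rat_seq :: "(nat \<Rightarrow> rat) \<Rightarrow> bool" where
  "computable_rat_seq a \<longleftrightarrow> computable_rat_fun 1 (\<lambda>xs. a (xs ! 0))"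

definition computable_rat_seq2 :: "(nat \<Rightarrow> nat \<Rightarrow> rat) \<Rightarrow> bool" where
  "computable_rat_seq2 a \<longleftrightarrow> computable_rat_fun 2 (\<lambda>xs. a (xs ! 0) (xs ! 1))"

text \<open>An interval with \<open>l n k \<ge> u n k\<close> is empty, so an enumeration may pause or stop; in particular
  the empty set is effectively open.\<close>

definition uniformly_effectively_open :: "(nat \<Rightarrow> real set) \<Rightarrow> bool" where
  "uniformly_effectively_open U \<longleftrightarrow>
    (\<exists>l u. computable_rat_seq2 l \<and> computable_rat_seq2 u \<and>
      (\<forall>n. U n = (\<Union>k. {real_of_rat (l n k) <..< real_of_rat (u n k)})))"

definition martin_loef_test :: "(nat \<Rightarrow> real set) \<Rightarrow> bool" where
  "martin_loef_test U \<longleftrightarrow>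
    uniformly_effectively_open U \<and> (\<forall>n. emeasure lborel (U n) \<le> ennreal ((1 / 2) ^ n))"

definition martin_loef_random :: "real \<Rightarrow> bool" where
  "martin_loef_random x \<longleftrightarrow> (\<forall>U. martin_loef_test U \<longrightarrow> x \<notin> (\<Inter>n. U n))"

end

theory Submission imports Defs begin

text \<open>If \<open>\<alpha>\<close> lies in every level of a test, each level \<open>n\<close> is turned into payments: whenever
  \<open>a i\<close> has moved past the right end reached so far and lies in one of the intervals enumerated up
  to stage \<open>i\<close>, pay the distance from \<open>a i\<close> to the largest right end of such an interval. The paid
  intervals are disjoint subsets of the level, so they cost at most \<open>(1 / 2) ^ n\<close>, and the last one
  reaches beyond \<open>\<alpha>\<close>. Level \<open>n\<close> pays only at stages \<open>i \<ge> n\<close>, and \<open>h i\<close> is the maximum of the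
  payments of all levels at stage \<open>i\<close>; the maximum, unlike the sum, needs no recursion on rationals.

  Conversely, \<open>\<alpha>\<close> lies in infinitely many intervals
  \<open>(a i - (1 / 2) ^ i, a i + h i + (1 / 2) ^ i)\<close> of finite total length \<open>\<le> 2 ^ c\<close>, and the points
  lying in at least \<open>2 ^ (n + c)\<close> of them form level \<open>n\<close> of a test by Markov's inequality. Since the
  left ends increase, this level is a union of intervals from a left end \<open>i\<close> to a right end
  \<open>j \<le> i\<close>; the pair is coded as \<open>i * i + j\<close>.\<close>

section \<open>Closure properties of computable functions\<close>

lemma computable_fun_cong:
  assumes "computable_fun k f" and "\<And>xs. length xs = k \<Longrightarrow> f xs = g xs"
  shows "computable_fun k g"
  using assms unfolding computable_fun_def by metis

lemma computable_fun_proj: "i < k \<Longrightarrow> computable_fun k (\<lambda>xs. xs ! i)"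
  unfolding computable_fun_def by (metis rec_eval.proj)

lemma computable_fun_comp:
  assumes "computable_fun (length gs) f" and "\<And>g. g \<in> set gs \<Longrightarrow> computable_fun k g"
  shows "computable_fun k (\<lambda>xs. f (map (\<lambda>g. g xs) gs))"
proof -
  obtain r where r: "\<And>xs. length xs = length gs \<Longrightarrow> rec_eval r xs (f xs)"
    using assms(1) unfolding computable_fun_def by blast
  obtain R where R: "\<And>g xs. g \<in> set gs \<Longrightarrow> length xs = k \<Longrightarrow> rec_eval (R g) xs (g xs)"
    using assms(2) unfolding computable_fun_def by metis
  have "rec_eval (RComp r (map R gs)) xs (f (map (\<lambda>g. g xs) gs))" if "length xs = k" for xs
    by (rule rec_eval.comp[where ys = "map (\<lambda>g. g xs) gs"])
      (auto simp: list_all2_conv_all_nth that intro: R r)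
  then show ?thesis
    unfolding computable_fun_def by blast
qed

lemma computable_fun_comp1:
  assumes "computable_fun 1 (\<lambda>xs. f (xs ! 0))" and "computable_fun k g"
  shows "computable_fun k (\<lambda>xs. f (g xs))"
  using computable_fun_comp[of "[g]" "\<lambda>xs. f (xs ! 0)" k] assms by simp

lemma computable_fun_comp2:
  assumes "computable_fun 2 (\<lambda>xs. f (xs ! 0) (xs ! 1))"
    and "computable_fun k g1" and "computable_fun k g2"
  shows "computable_fun k (\<lambda>xs. f (g1 xs) (g2 xs))"
  using computable_fun_comp[of "[g1, g2]" "\<lambda>xs. f (xs ! 0) (xs ! 1)" k] assms
  by (auto simp: numeral_2_eq_2)

lemma computable_fun_Suc: "computable_fun k f \<Longrightarrow> computable_fun k (\<lambda>xs. Suc (f xs))"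
  by (rule computable_fun_comp1[of Suc])
    (auto simp: computable_fun_def length_Suc_conv intro!: exI[of _ RSucc] rec_eval.succ)

lemma computable_fun_const: "computable_fun k (\<lambda>xs. c)"
proof (induction c)
  case 0
  then show ?case unfolding computable_fun_def by (meson rec_eval.zero)
next
  case (Suc c)
  then show ?case by (rule computable_fun_Suc)
qed

text \<open>These accessors use \<open>hd\<close> and \<open>tl\<close> because the step function of
  a recursion receives its counter, the previous value and the parameters in one argument
  list.\<close>

lemma computable_fun_hd: "0 < k \<Longrightarrow> computable_fun k hd"
  by (rule computable_fun_cong[OF computable_fun_proj[of 0]]) (auto simp: hd_conv_nth)

lemma computable_fun_hd_tl: "1 < k \<Longrightarrow> computable_fun k (\<lambda>xs. hd (tl xs))"
  by (rule computable_fun_cong[OF computable_fun_proj[of 1]])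
    (auto simp: hd_conv_nth nth_tl simp flip: length_greater_0_conv)

lemma computable_fun_tl_nth: "i + 1 < k \<Longrightarrow> computable_fun k (\<lambda>xs. tl xs ! i)"
  by (rule computable_fun_cong[OF computable_fun_proj[of "i + 1"]]) (auto simp: nth_tl)

lemma computable_fun_tl_tl_nth: "i + 2 < k \<Longrightarrow> computable_fun k (\<lambda>xs. tl (tl xs) ! i)"
  by (rule computable_fun_cong[OF computable_fun_proj[of "i + 2"]]) (auto simp: nth_tl)

text \<open>\<open>RPrim\<close> recurses on the first entry of its argument list. Composing with
  \<open>t\<close> and with all projections puts the recursion depth in front of the unchanged
  parameters \<open>xs\<close>.\<close>

lemma computable_fun_rec_nat:
  assumes t: "computable_fun k t" and f: "computable_fun k f"
    and g: "computable_fun (Suc (Suc k)) (\<lambda>ys. g (hd ys) (hd (tl ys)) (tl (tl ys)))"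
  shows "computable_fun k (\<lambda>xs. rec_nat (f xs) (\<lambda>n y. g n y xs) (t xs))"
proof -
  obtain rf where rf: "\<And>xs. length xs = k \<Longrightarrow> rec_eval rf xs (f xs)"
    using f unfolding computable_fun_def by blast
  obtain rg where rg: "\<And>n y xs. length xs = k \<Longrightarrow> rec_eval rg (n # y # xs) (g n y xs)"
    using g unfolding computable_fun_def by (metis length_Cons list.sel(1,3))
  have ev: "rec_eval (RPrim rf rg) (n # xs) (rec_nat (f xs) (\<lambda>n y. g n y xs) n)"
    if "length xs = k" for n xs
    using that by (induction n) (auto intro: rec_eval.prim_0 rec_eval.prim_Suc rf rg)
  let ?R = "\<lambda>ys. rec_nat (f (tl ys)) (\<lambda>n y. g n y (tl ys)) (hd ys)"
  have "rec_eval (RPrim rf rg) ys (?R ys)" if "length ys = Suc k" for ys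
    using that ev by (cases ys) auto
  then have "computable_fun (Suc k) ?R"
    unfolding computable_fun_def by blast
  then have "computable_fun k (\<lambda>xs. ?R (map (\<lambda>g. g xs) (t # map (\<lambda>i xs. xs ! i) [0..<k])))"
    by (intro computable_fun_comp) (auto intro: computable_fun_proj t)
  then show ?thesis
    by (rule computable_fun_cong) (auto simp: o_def map_nth)
qed

section \<open>Arithmetic by primitive recursion\<close>

lemma computable_fun_pred:
  assumes "computable_fun k f" shows "computable_fun k (\<lambda>xs. f xs - 1)"
proof -
  have "computable_fun k (\<lambda>xs. rec_nat 0 (\<lambda>n y. n) (f xs))"
    by (intro computable_fun_rec_nat computable_fun_const computable_fun_hd assms) simp
  then show ?thesis
  proof (rule computable_fun_cong)
    show "rec_nat 0 (\<lambda>n y. n) (f xs) = f xs - 1" for xs by (cases "f xs") auto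
  qed
qed

lemma computable_fun_add:
  assumes "computable_fun k f" "computable_fun k g" shows "computable_fun k (\<lambda>xs. f xs + g xs)"
proof -
  have "computable_fun 2 (\<lambda>xs. rec_nat (xs ! 0) (\<lambda>n y. Suc y) (xs ! 1))"
    by (intro computable_fun_rec_nat computable_fun_Suc computable_fun_hd_tl computable_fun_proj) auto
  moreover have "rec_nat x (\<lambda>n y. Suc y) z = x + z" for x z by (induction z) auto
  ultimately show ?thesis using computable_fun_comp2[of "(+)"] assms by simp
qed

lemma computable_fun_diff:
  assumes "computable_fun k f" "computable_fun k g" shows "computable_fun k (\<lambda>xs. f xs - g xs)"
proof -
  have "computable_fun 2 (\<lambda>xs. rec_nat (xs ! 0) (\<lambda>n y. y - 1) (xs ! 1))"
    by (intro computable_fun_rec_nat computable_fun_pred computable_fun_hd_tl computable_fun_proj) auto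
  moreover have "rec_nat x (\<lambda>n y. y - 1) z = x - z" for x z :: nat by (induction z) auto
  ultimately show ?thesis using computable_fun_comp2[of "(-)"] assms by simp
qed

lemma computable_fun_mult:
  assumes "computable_fun k f" "computable_fun k g" shows "computable_fun k (\<lambda>xs. f xs * g xs)"
proof -
  have "computable_fun 2 (\<lambda>xs. rec_nat 0 (\<lambda>n y. xs ! 0 + y) (xs ! 1))"
    by (intro computable_fun_rec_nat computable_fun_add computable_fun_const computable_fun_hd_tl
        computable_fun_proj computable_fun_tl_tl_nth) auto
  moreover have "rec_nat 0 (\<lambda>n y. x + y) z = x * z" for x z :: nat by (induction z) auto
  ultimately show ?thesis using computable_fun_comp2[of "(*)"] assms by simp
qed

lemma computable_fun_power:
  assumes "computable_fun k f" "computable_fun k g" shows "computable_fun k (\<lambda>xs. f xs ^ g xs)"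
proof -
  have "computable_fun 2 (\<lambda>xs. rec_nat 1 (\<lambda>n y. xs ! 0 * y) (xs ! 1))"
    by (intro computable_fun_rec_nat computable_fun_mult computable_fun_const computable_fun_hd_tl
        computable_fun_proj computable_fun_tl_tl_nth) auto
  moreover have "rec_nat 1 (\<lambda>n y. x * y) z = x ^ z" for x z :: nat by (induction z) auto
  ultimately show ?thesis using computable_fun_comp2[of "(^)"] assms by simp
qed

lemma computable_fun_sum:
  assumes "computable_fun k t" and "computable_fun (Suc k) (\<lambda>ys. f (hd ys) (tl ys))"
  shows "computable_fun k (\<lambda>xs. \<Sum>m<t xs. f m xs)"
proof -
  \<comment> \<open>Inside the recursion the accumulated value sits between the counter and the
    parameters; composing with projections drops it.\<close>
  have "computable_fun (Suc (Suc k)) (\<lambda>ys. f (hd ys) (tl (tl ys)))"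
  proof -
    let ?gs = "hd # map (\<lambda>i xs. tl (tl xs) ! i) [0..<k]"
    have "computable_fun (Suc (Suc k)) (\<lambda>ys. (\<lambda>ys. f (hd ys) (tl ys)) (map (\<lambda>g. g ys) ?gs))"
      using assms(2) by (intro computable_fun_comp) (auto intro: computable_fun_hd computable_fun_tl_tl_nth)
    then show ?thesis
    proof (rule computable_fun_cong)
      show "f (hd (map (\<lambda>g. g ys) ?gs)) (tl (map (\<lambda>g. g ys) ?gs)) = f (hd ys) (tl (tl ys))"
        if "length ys = Suc (Suc k)" for ys
        using that map_nth[of "tl (tl ys)"] by (simp add: o_def)
    qed
  qed
  then have "computable_fun k (\<lambda>xs. rec_nat 0 (\<lambda>n y. y + f n xs) (t xs))"
    by (intro computable_fun_rec_nat computable_fun_add computable_fun_const computable_fun_hd_tl assms) auto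
  moreover have "rec_nat 0 (\<lambda>n y. y + f n xs) z = (\<Sum>m<z. f m xs)" for xs z
    by (induction z) auto
  ultimately show ?thesis by simp
qed

section \<open>Decidable predicates, bounded counting and search\<close>

definition decidable_pred :: "nat \<Rightarrow> (nat list \<Rightarrow> bool) \<Rightarrow> bool" where
  "decidable_pred k P \<longleftrightarrow> computable_fun k (\<lambda>xs. of_bool (P xs))"

lemma decidable_le:
  assumes "computable_fun k f" "computable_fun k g" shows "decidable_pred k (\<lambda>xs. f xs \<le> g xs)"
  unfolding decidable_pred_def
  by (rule computable_fun_cong[of _ "\<lambda>xs. 1 - (f xs - g xs)"])
    (auto intro!: computable_fun_diff computable_fun_const assms)

lemma decidable_not:
  assumes "decidable_pred k P" shows "decidable_pred k (\<lambda>xs. \<not> P xs)"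
  using assms unfolding decidable_pred_def
  by (rule_tac computable_fun_cong[of _ "\<lambda>xs. 1 - of_bool (P xs)"])
    (auto intro!: computable_fun_diff computable_fun_const)

lemma decidable_conj:
  assumes "decidable_pred k P" "decidable_pred k Q" shows "decidable_pred k (\<lambda>xs. P xs \<and> Q xs)"
  using assms unfolding decidable_pred_def
  by (rule_tac computable_fun_cong[of _ "\<lambda>xs. of_bool (P xs) * of_bool (Q xs)"])
    (auto intro!: computable_fun_mult)

lemma decidable_disj:
  assumes "decidable_pred k P" "decidable_pred k Q" shows "decidable_pred k (\<lambda>xs. P xs \<or> Q xs)"
  using decidable_not[OF decidable_conj[OF assms[THEN decidable_not]]] by simp

lemma decidable_imp:
  assumes "decidable_pred k P" "decidable_pred k Q" shows "decidable_pred k (\<lambda>xs. P xs \<longrightarrow> Q xs)"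
  using decidable_disj[OF decidable_not[OF assms(1)] assms(2)] by (simp only: imp_conv_disj)

lemma decidable_less:
  assumes "computable_fun k f" "computable_fun k g" shows "decidable_pred k (\<lambda>xs. f xs < g xs)"
  using decidable_not[OF decidable_le[OF assms(2,1)]] by (simp add: not_le)

lemma decidable_eq:
  fixes f :: "nat list \<Rightarrow> nat"
  assumes "computable_fun k f" "computable_fun k g" shows "decidable_pred k (\<lambda>xs. f xs = g xs)"
  using decidable_conj[OF decidable_le[OF assms] decidable_le[OF assms(2,1)]]
  by (simp add: eq_iff)

lemma computable_fun_if:
  assumes "decidable_pred k P" "computable_fun k f" "computable_fun k g"
  shows "computable_fun k (\<lambda>xs. if P xs then f xs else g xs)"
  using assms decidable_not[OF assms(1)] unfolding decidable_pred_def
  by (rule_tac computable_fun_cong[of _ "\<lambda>xs. of_bool (P xs) * f xs + of_bool (\<not> P xs) * g xs"])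
    (intro computable_fun_add computable_fun_mult, auto)

lemma computable_fun_count:
  assumes "computable_fun k t" "decidable_pred (Suc k) (\<lambda>ys. P (hd ys) (tl ys))"
  shows "computable_fun k (\<lambda>xs. card {m. m < t xs \<and> P m xs})"
proof -
  have "(\<Sum>m<z. of_bool (P m xs)) = card {m. m < z \<and> P m xs}" for z xs
  proof -
    have "{..<z} \<inter> {m. P m xs} = {m. m < z \<and> P m xs}" by auto
    then show ?thesis by (simp add: of_bool_def sum.If_cases)
  qed
  then show ?thesis
    using computable_fun_sum[OF assms(1), of "\<lambda>m xs. of_bool (P m xs)"] assms(2)
    by (simp add: decidable_pred_def)
qed

lemma decidable_all_less:
  assumes "computable_fun k t" "decidable_pred (Suc k) (\<lambda>ys. P (hd ys) (tl ys))"
  shows "decidable_pred k (\<lambda>xs. \<forall>m<t xs. P m xs)"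
proof -
  have "decidable_pred k (\<lambda>xs. card {m. m < t xs \<and> \<not> P m xs} = 0)"
    using assms by (intro decidable_eq computable_fun_count computable_fun_const decidable_not)
  moreover have "(card {m. m < t xs \<and> \<not> P m xs} = 0) = (\<forall>m<t xs. P m xs)" for xs
    by (subst card_eq_0_iff) auto
  ultimately show ?thesis by simp
qed

lemma computable_fun_Least:
  assumes "decidable_pred (Suc k) (\<lambda>ys. P (hd ys) (tl ys))"
    and ex: "\<And>xs. length xs = k \<Longrightarrow> \<exists>n. P n xs"
  shows "computable_fun k (\<lambda>xs. LEAST n. P n xs)"
proof -
  \<comment> \<open>\<open>RMin\<close> searches for the value 0, hence the characteristic function
    of the negation.\<close>
  have "computable_fun (Suc k) (\<lambda>ys. of_bool (\<not> P (hd ys) (tl ys)))"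
    using decidable_not[OF assms(1)] by (simp add: decidable_pred_def)
  then obtain r where r:
    "\<And>n xs. length xs = k \<Longrightarrow> rec_eval r (n # xs) (of_bool (\<not> P n xs))"
    unfolding computable_fun_def by (metis length_Cons list.sel(1,3))
  have "rec_eval (RMin r) xs (LEAST n. P n xs)" if "length xs = k" for xs
  proof (rule rec_eval.min)
    show "rec_eval r ((LEAST n. P n xs) # xs) 0"
      using r[OF that, of "LEAST n. P n xs"] LeastI_ex[OF ex[OF that]] by simp
    show "\<exists>y. rec_eval r (m # xs) (Suc y)" if "m < (LEAST n. P n xs)" for m
      using r[OF \<open>length xs = k\<close>, of m] not_less_Least[OF that] by auto
  qed
  then show ?thesis unfolding computable_fun_def by blast
qed

section \<open>Computable rational functions\<close>

text \<open>Without a separate sign, sums and differences need only polynomial expressions in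
  natural numbers, with no case distinction on signs.\<close>

lemma computable_rat_fun_iff_diff:
  "computable_rat_fun k q \<longleftrightarrow> (\<exists>p m d. computable_fun k p \<and> computable_fun k m \<and> computable_fun k d \<and>
     (\<forall>xs. length xs = k \<longrightarrow> d xs \<noteq> 0 \<and> q xs = (of_nat (p xs) - of_nat (m xs)) / of_nat (d xs)))"
  (is "?L \<longleftrightarrow> ?R")
proof
  assume ?L
  then obtain s n d where c: "computable_fun k s" "computable_fun k n" "computable_fun k d"
    and q: "\<And>xs. length xs = k \<Longrightarrow> d xs \<noteq> 0 \<and> q xs = (- 1) ^ s xs * (of_nat (n xs) / of_nat (d xs))"
    unfolding computable_rat_fun_def by blast
  \<comment> \<open>The sign depends only on the parity of \<open>s xs\<close>, which is computed by
    flipping a bit \<open>s xs\<close> times.\<close>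
  have "computable_fun 1 (\<lambda>xs. rec_nat 0 (\<lambda>n y. 1 - y) (xs ! 0))"
    by (intro computable_fun_rec_nat computable_fun_diff computable_fun_const computable_fun_hd_tl
        computable_fun_proj) auto
  moreover have "rec_nat 0 (\<lambda>n y. 1 - y) z = (of_bool (odd z) :: nat)" for z
    by (induction z) auto
  ultimately have odd: "computable_fun k (\<lambda>xs. of_bool (odd (s xs)))"
    using computable_fun_comp1[OF _ c(1), of "\<lambda>z. of_bool (odd z)"] by simp
  show ?R
  proof (intro exI conjI)
    show "computable_fun k (\<lambda>xs. (1 - of_bool (odd (s xs))) * n xs)"
      by (intro computable_fun_mult computable_fun_diff computable_fun_const odd c)
    show "computable_fun k (\<lambda>xs. of_bool (odd (s xs)) * n xs)"
      by (intro computable_fun_mult odd c)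
    show "computable_fun k d" by (fact c)
  qed (use q in auto)
next
  assume ?R
  then obtain p m d where c: "computable_fun k p" "computable_fun k m" "computable_fun k d"
    and q: "\<And>xs. length xs = k \<Longrightarrow> d xs \<noteq> 0 \<and> q xs = (of_nat (p xs) - of_nat (m xs)) / of_nat (d xs)"
    by blast
  show ?L unfolding computable_rat_fun_def
  proof (intro exI conjI)
    show "computable_fun k (\<lambda>xs. of_bool (p xs < m xs))"
      using decidable_less[OF c(1,2)] by (simp add: decidable_pred_def)
    \<comment> \<open>One of the two truncated differences is 0, so their sum is the absolute
      difference.\<close>
    show "computable_fun k (\<lambda>xs. (p xs - m xs) + (m xs - p xs))"
      by (intro computable_fun_add computable_fun_diff c)
    show "computable_fun k d" by (fact c)
  qed (use q in \<open>auto simp: of_nat_diff not_less\<close>)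
qed

lemma computable_rat_fun_comp:
  assumes "computable_rat_fun (length gs) q" and "\<And>g. g \<in> set gs \<Longrightarrow> computable_fun k g"
  shows "computable_rat_fun k (\<lambda>xs. q (map (\<lambda>g. g xs) gs))"
proof -
  obtain s n d where c: "computable_fun (length gs) s" "computable_fun (length gs) n" "computable_fun (length gs) d"
    and q: "\<forall>xs. length xs = length gs \<longrightarrow> d xs \<noteq> 0 \<and> q xs = (- 1) ^ s xs * (of_nat (n xs) / of_nat (d xs))"
    using assms(1) unfolding computable_rat_fun_def by blast
  show ?thesis
    unfolding computable_rat_fun_def
  proof (intro exI conjI)
    let ?e = "\<lambda>xs. map (\<lambda>g. g xs) gs"
    show "computable_fun k (\<lambda>xs. s (?e xs))" "computable_fun k (\<lambda>xs. n (?e xs))"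
      "computable_fun k (\<lambda>xs. d (?e xs))"
      using c assms(2) by (auto intro: computable_fun_comp)
  qed (use q in auto)
qed

lemma computable_rat_seq_comp:
  assumes "computable_rat_seq a" "computable_fun k f"
  shows "computable_rat_fun k (\<lambda>xs. a (f xs))"
  using computable_rat_fun_comp[of "[f]" "\<lambda>xs. a (xs ! 0)" k] assms
  by (simp add: computable_rat_seq_def)

lemma computable_rat_seq2_comp:
  assumes "computable_rat_seq2 a" "computable_fun k f" "computable_fun k g"
  shows "computable_rat_fun k (\<lambda>xs. a (f xs) (g xs))"
  using computable_rat_fun_comp[of "[f, g]" "\<lambda>xs. a (xs ! 0) (xs ! 1)" k] assms
  by (auto simp: computable_rat_seq2_def numeral_2_eq_2)

lemma computable_rat_fun_const_0: "computable_rat_fun k (\<lambda>xs. 0)"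
  unfolding computable_rat_fun_iff_diff
  by (intro exI[of _ "\<lambda>xs. 0"] exI[of _ "\<lambda>xs. 1"] conjI computable_fun_const) auto

lemma computable_rat_fun_inverse_power:
  assumes "computable_fun k f"
  shows "computable_rat_fun k (\<lambda>xs. (1 / 2) ^ f xs)"
  unfolding computable_rat_fun_iff_diff
  by (intro exI[of _ "\<lambda>xs. 1"] exI[of _ "\<lambda>xs. 0"] exI[of _ "\<lambda>xs. 2 ^ f xs"] conjI computable_fun_const
      computable_fun_power assms) (auto simp: power_one_over)

lemma computable_rat_fun_add:
  assumes "computable_rat_fun k q" "computable_rat_fun k r"
  shows "computable_rat_fun k (\<lambda>xs. q xs + r xs)"
proof -
  obtain p m d where c: "computable_fun k p" "computable_fun k m" "computable_fun k d"
    and q: "\<And>xs. length xs = k \<Longrightarrow> d xs \<noteq> 0 \<and> q xs = (of_nat (p xs) - of_nat (m xs)) / of_nat (d xs)"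
    using assms(1) unfolding computable_rat_fun_iff_diff by blast
  obtain p' m' d' where c': "computable_fun k p'" "computable_fun k m'" "computable_fun k d'"
    and r: "\<And>xs. length xs = k \<Longrightarrow> d' xs \<noteq> 0 \<and> r xs = (of_nat (p' xs) - of_nat (m' xs)) / of_nat (d' xs)"
    using assms(2) unfolding computable_rat_fun_iff_diff by blast
  show ?thesis
    unfolding computable_rat_fun_iff_diff
  proof (intro exI conjI)
    show "computable_fun k (\<lambda>xs. p xs * d' xs + p' xs * d xs)"
      "computable_fun k (\<lambda>xs. m xs * d' xs + m' xs * d xs)"
      "computable_fun k (\<lambda>xs. d xs * d' xs)"
      by (intro computable_fun_add computable_fun_mult c c')+
  qed (use q r in \<open>auto simp: field_simps\<close>)
qed

lemma computable_rat_fun_diff: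
  assumes "computable_rat_fun k q" "computable_rat_fun k r"
  shows "computable_rat_fun k (\<lambda>xs. q xs - r xs)"
proof -
  obtain p m d where c: "computable_fun k p" "computable_fun k m" "computable_fun k d"
    and r: "\<forall>xs. length xs = k \<longrightarrow> d xs \<noteq> 0 \<and> r xs = (of_nat (p xs) - of_nat (m xs)) / of_nat (d xs)"
    using assms(2) unfolding computable_rat_fun_iff_diff by blast
  have "computable_rat_fun k (\<lambda>xs. - r xs)"
    unfolding computable_rat_fun_iff_diff
    by (rule exI[of _ m], rule exI[of _ p], rule exI[of _ d]) (use c r in \<open>auto simp: field_simps\<close>)
  from computable_rat_fun_add[OF assms(1) this] show ?thesis by simp
qed

text \<open>The denominator of \<open>r xs - q xs\<close> is positive, so comparing the two natural
  numbers in its numerator decides the sign.\<close>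

lemma decidable_rat_less:
  assumes "computable_rat_fun k q" "computable_rat_fun k r"
  shows "decidable_pred k (\<lambda>xs. q xs < r xs)"
proof -
  obtain s n d where c: "computable_fun k s" "computable_fun k n" "computable_fun k d"
    and e: "\<And>xs. length xs = k \<Longrightarrow> d xs \<noteq> 0 \<and> r xs - q xs = (of_nat (s xs) - of_nat (n xs)) / of_nat (d xs)"
    using computable_rat_fun_diff[OF assms(2,1)] unfolding computable_rat_fun_iff_diff by blast
  have "(n xs < s xs) = (q xs < r xs)" if "length xs = k" for xs
  proof -
    have "(q xs < r xs) = (0 < (of_nat (s xs) - of_nat (n xs)) / (of_nat (d xs) :: rat))"
      using e[OF that] by (metis diff_gt_0_iff_gt)
    also have "\<dots> = (n xs < s xs)" using e[OF that] by (simp add: zero_less_divide_iff)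
    finally show ?thesis by simp
  qed
  then show ?thesis
    using computable_fun_cong[OF decidable_less[OF c(2,1), unfolded decidable_pred_def]]
    by (simp add: decidable_pred_def)
qed

lemma decidable_rat_le:
  assumes "computable_rat_fun k q" "computable_rat_fun k r"
  shows "decidable_pred k (\<lambda>xs. q xs \<le> r xs)"
  using decidable_not[OF decidable_rat_less[OF assms(2,1)]] by (simp add: not_less)

lemma computable_rat_fun_if:
  assumes "decidable_pred k P" "computable_rat_fun k q" "computable_rat_fun k r"
  shows "computable_rat_fun k (\<lambda>xs. if P xs then q xs else r xs)"
proof -
  obtain p m d where c: "computable_fun k p" "computable_fun k m" "computable_fun k d"
    and q: "\<And>xs. length xs = k \<Longrightarrow> d xs \<noteq> 0 \<and> q xs = (of_nat (p xs) - of_nat (m xs)) / of_nat (d xs)"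
    using assms(2) unfolding computable_rat_fun_iff_diff by blast
  obtain p' m' d' where c': "computable_fun k p'" "computable_fun k m'" "computable_fun k d'"
    and r: "\<And>xs. length xs = k \<Longrightarrow> d' xs \<noteq> 0 \<and> r xs = (of_nat (p' xs) - of_nat (m' xs)) / of_nat (d' xs)"
    using assms(3) unfolding computable_rat_fun_iff_diff by blast
  show ?thesis
    unfolding computable_rat_fun_iff_diff
  proof (intro exI conjI)
    show "computable_fun k (\<lambda>xs. if P xs then p xs else p' xs)"
      "computable_fun k (\<lambda>xs. if P xs then m xs else m' xs)"
      "computable_fun k (\<lambda>xs. if P xs then d xs else d' xs)"
      by (intro computable_fun_if c c' assms(1))+
  qed (use q r in auto)
qed

lemmas computable_intros =
  computable_fun_proj computable_fun_hd computable_fun_hd_tl computable_fun_tl_nth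
  computable_fun_tl_tl_nth computable_fun_const computable_fun_Suc computable_fun_pred
  computable_fun_add computable_fun_diff computable_fun_mult computable_fun_power computable_fun_if
  computable_fun_count computable_fun_Least
  decidable_not decidable_conj decidable_disj decidable_imp decidable_le decidable_less decidable_eq
  decidable_all_less decidable_rat_less decidable_rat_le
  computable_rat_fun_const_0 computable_rat_fun_inverse_power computable_rat_fun_add
  computable_rat_fun_diff computable_rat_fun_if

section \<open>From a test to a summable majorant\<close>

locale interval_family =
  fixes a :: "nat \<Rightarrow> rat" and l u :: "nat \<Rightarrow> nat \<Rightarrow> rat"
  assumes incseq_a: "incseq a"
begin

text \<open>The value is greater than \<open>i\<close> if none of the first \<open>i + 1\<close> intervals of level \<open>n\<close>
  contains \<open>a i\<close>.\<close>

definition best :: "nat \<Rightarrow> nat \<Rightarrow> nat" where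
  "best n i = (LEAST k. i < k \<or> (l n k < a i \<and> a i < u n k \<and>
     (\<forall>k'<Suc i. l n k' < a i \<and> a i < u n k' \<longrightarrow> u n k' \<le> u n k)))"

text \<open>\<open>Suc k\<close> stands for the right end \<open>u n k\<close>, and \<open>0\<close> for no payment yet.\<close>

primrec reach :: "nat \<Rightarrow> nat \<Rightarrow> nat" where
  "reach n 0 = 0"
| "reach n (Suc i) =
    (if i < n \<or> i < best n i \<or> (reach n i \<noteq> 0 \<and> a i < u n (reach n i - 1))
     then reach n i else Suc (best n i))"

text \<open>Comparing \<open>reach\<close> before and after a stage misses no payment: a new right
  end lies beyond \<open>a i\<close>, while the old one, if any, does not.\<close>

definition pay :: "nat \<Rightarrow> nat \<Rightarrow> rat" where
  "pay n i = (if reach n (Suc i) = reach n i then 0 else u n (reach n (Suc i) - 1) - a i)"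

text \<open>The maximum is written as the value at an index found by search, so its computability
  reduces to that of \<open>pay\<close>.\<close>

definition payment :: "nat \<Rightarrow> rat" where
  "payment i = pay (LEAST n. \<forall>m<Suc i. pay m i \<le> pay n i) i"

abbreviation cover :: "nat \<Rightarrow> real set" where
  "cover n \<equiv> \<Union>k. {real_of_rat (l n k) <..< real_of_rat (u n k)}"

section \<open>Properties of the payment strategy\<close>

lemma best_le:
  assumes "k \<le> i" "l n k < a i" "a i < u n k"
  shows "best n i \<le> i"
proof -
  let ?K = "{k. k \<le> i \<and> l n k < a i \<and> a i < u n k}"
  have fin: "finite (u n ` ?K)" by simp
  have ne: "u n ` ?K \<noteq> {}" using assms by auto
  \<comment> \<open>Among the finitely many candidates, one with the largest right end meets the
    search condition of \<open>best\<close>.\<close>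
  obtain k0 where k0: "k0 \<in> ?K" "u n k0 = Max (u n ` ?K)"
    using Max_in[OF fin ne] by auto
  have "u n k' \<le> u n k0" if "k' \<in> ?K" for k'
    unfolding k0(2) using that fin by (intro Max_ge) auto
  then have "best n i \<le> k0"
    unfolding best_def using k0(1) by (intro Least_le) (auto simp: less_Suc_eq_le)
  with k0(1) show ?thesis by auto
qed

lemma best_props:
  assumes "best n i \<le> i"
  shows "l n (best n i) < a i" "a i < u n (best n i)"
    "\<And>k. k \<le> i \<Longrightarrow> l n k < a i \<Longrightarrow> a i < u n k \<Longrightarrow> u n k \<le> u n (best n i)"
proof -
  \<comment> \<open>\<open>Suc i\<close> meets the search condition through its first disjunct, so
    the search succeeds; the assumption then excludes that disjunct.\<close>
  have "i < best n i \<or> (l n (best n i) < a i \<and> a i < u n (best n i) \<and>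
     (\<forall>k'<Suc i. l n k' < a i \<and> a i < u n k' \<longrightarrow> u n k' \<le> u n (best n i)))"
    unfolding best_def by (rule LeastI[of _ "Suc i"]) simp
  with assms show "l n (best n i) < a i" "a i < u n (best n i)"
    "\<And>k. k \<le> i \<Longrightarrow> l n k < a i \<Longrightarrow> a i < u n k \<Longrightarrow> u n k \<le> u n (best n i)"
    by (auto simp: less_Suc_eq_le)
qed

text \<open>The last fact is what makes the paid intervals disjoint: a new one starts at
  \<open>a i\<close>, at or past the previous right end.\<close>

lemma reach_change:
  assumes "reach n (Suc i) \<noteq> reach n i"
  shows "n \<le> i" "best n i \<le> i" "reach n (Suc i) = Suc (best n i)" "pay n i = u n (best n i) - a i"
    "reach n i = 0 \<or> u n (reach n i - 1) \<le> a i"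
  using assms by (auto simp: pay_def split: if_splits)

lemma pay_nonneg: "0 \<le> pay n i"
  using reach_change[of n i] best_props(2)[of n i]
  by (cases "reach n (Suc i) = reach n i") (auto simp: pay_def simp del: reach.simps)

lemma pay_eq_0: "i < n \<Longrightarrow> pay n i = 0"
  by (simp add: pay_def)

lemma ex_max_pay: "\<exists>n. \<forall>m<Suc i. pay m i \<le> pay n i"
proof -
  let ?M = "Max ((\<lambda>m. pay m i) ` {..i})"
  have "?M \<in> (\<lambda>m. pay m i) ` {..i}" by (intro Max_in) auto
  then obtain n where n: "?M = pay n i" by (rule imageE)
  have "pay m i \<le> ?M" if "m < Suc i" for m
    using that by (intro Max_ge) auto
  then show ?thesis unfolding n by blast
qed

lemma pay_le_payment: "n \<le> i \<Longrightarrow> pay n i \<le> payment i"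
  using LeastI_ex[OF ex_max_pay[of i]] by (simp add: payment_def)

lemma payment_le_sum: "payment i \<le> (\<Sum>n\<le>i. pay n i)"
proof -
  obtain n where n: "payment i = pay n i" unfolding payment_def by blast
  show ?thesis
  proof (cases "n \<le> i")
    case True
    then show ?thesis unfolding n by (intro member_le_sum) (auto intro: pay_nonneg)
  next
    case False
    then show ?thesis unfolding n by (simp add: pay_eq_0 pay_nonneg sum_nonneg)
  qed
qed

lemma payment_nonneg: "0 \<le> payment i"
  by (simp add: payment_def pay_nonneg)

section \<open>The cost of a level against its measure\<close>

lemma open_cover: "open (cover n)"
  by (intro open_UN ballI open_greaterThanLessThan)

text \<open>Cutting the level off at \<open>x\<close> makes the induction work: the part left of the
  newly paid interval accounts for the earlier payments, and the new interval for itself.\<close>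

lemma sum_pay_le_emeasure_below:
  "reach n N = 0 \<or> real_of_rat (u n (reach n N - 1)) \<le> x \<Longrightarrow>
    ennreal (\<Sum>i<N. real_of_rat (pay n i)) \<le> emeasure lborel (cover n \<inter> {..<x})"
proof (induction N arbitrary: x)
  case 0
  then show ?case by simp
next
  case (Suc N)
  show ?case
  proof (cases "reach n (Suc N) = reach n N")
    case True
    then show ?thesis
      using Suc by (simp add: pay_def del: reach.simps)
  next
    case False
    note ch = reach_change[OF False]
    let ?b = "best n N"
    let ?A = "cover n \<inter> {..<real_of_rat (a N)}"
    let ?I = "{real_of_rat (a N) <..< real_of_rat (u n ?b)}"
    have b: "l n ?b < a N" "a N < u n ?b" using best_props[OF ch(2)] by auto
    have x: "real_of_rat (u n ?b) \<le> x" using Suc.prems ch(3) by simp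
    \<comment> \<open>The induction hypothesis is applied with the cut moved back to
      \<open>a N\<close>, which is allowed because the earlier right end is at most
      \<open>a N\<close>.\<close>
    have "ennreal (\<Sum>i<N. real_of_rat (pay n i)) \<le> emeasure lborel ?A"
      using ch(5) by (intro Suc.IH) (auto simp: of_rat_less_eq)
    moreover have "ennreal (real_of_rat (pay n N)) = emeasure lborel ?I"
      using b by (simp add: ch(4) of_rat_diff of_rat_less_eq less_imp_le)
    ultimately have "ennreal (\<Sum>i<Suc N. real_of_rat (pay n i)) \<le> emeasure lborel ?A + emeasure lborel ?I"
      by (simp add: ennreal_plus sum_nonneg pay_nonneg zero_le_of_rat_iff add_right_mono)
    also have "\<dots> = emeasure lborel (?A \<union> ?I)"
      using open_cover by (intro plus_emeasure) auto
    also have "?I \<subseteq> cover n"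
    proof
      fix y assume "y \<in> ?I"
      then have "y \<in> {real_of_rat (l n ?b) <..< real_of_rat (u n ?b)}"
        using b(1) by (auto simp: of_rat_less intro: less_trans[of "real_of_rat (l n ?b)" "real_of_rat (a N)" y])
      then show "y \<in> cover n" by blast
    qed
    then have "emeasure lborel (?A \<union> ?I) \<le> emeasure lborel (cover n \<inter> {..<x})"
      using x b(2) open_cover of_rat_less[of "a N" "u n ?b", where 'a = real]
      by (intro emeasure_mono) auto
    finally show ?thesis .
  qed
qed

lemma sum_pay_le_emeasure:
  "ennreal (\<Sum>i<N. real_of_rat (pay n i)) \<le> emeasure lborel (cover n)"
  using order_trans[OF sum_pay_le_emeasure_below[of n N "real_of_rat (u n (reach n N - 1))"]
      emeasure_mono[of _ "cover n"]] open_cover by auto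

lemma summable_payment:
  assumes small: "\<And>n. emeasure lborel (cover n) \<le> ennreal ((1 / 2) ^ n)"
  shows "summable (\<lambda>i. real_of_rat (payment i))"
proof (rule summableI_nonneg_bounded)
  fix N
  have level: "(\<Sum>i<N. real_of_rat (pay n i)) \<le> (1 / 2) ^ n" for n
    using order_trans[OF sum_pay_le_emeasure small] by (simp add: ennreal_le_iff)
  have "(\<Sum>i<N. real_of_rat (payment i)) \<le> (\<Sum>i<N. \<Sum>n\<le>i. real_of_rat (pay n i))"
    using payment_le_sum by (intro sum_mono) (simp add: of_rat_less_eq flip: of_rat_sum)
  \<comment> \<open>Payments are non-negative, so the inner range may grow to a fixed one; after
    swapping, each level is bounded separately.\<close>
  also have "\<dots> \<le> (\<Sum>i<N. \<Sum>n<N. real_of_rat (pay n i))"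
    by (intro sum_mono sum_mono2) (auto simp: zero_le_of_rat_iff pay_nonneg)
  also have "\<dots> = (\<Sum>n<N. \<Sum>i<N. real_of_rat (pay n i))" by (rule sum.swap)
  also have "\<dots> \<le> (\<Sum>n<N. (1 / 2) ^ n)" by (intro sum_mono level)
  also have "\<dots> \<le> (\<Sum>n. (1 / 2) ^ n)" by (intro sum_le_suminf) (auto intro: summable_geometric)
  also have "\<dots> = 2" by (simp add: suminf_geometric)
  finally show "(\<Sum>i<N. real_of_rat (payment i)) \<le> 2" .
qed (simp add: payment_nonneg zero_le_of_rat_iff)

text \<open>Eventually an interval around \<alpha> contains \<open>a i\<close> as well. A payment
  from then on reaches past its right end. Without one, the right end already reached stays above
  all later \<open>a i\<close>, hence is at least \<alpha>, and the payment that set it is the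
  required one.\<close>

lemma pay_reaches:
  assumes lim: "(\<lambda>i. real_of_rat (a i)) \<longlonglongrightarrow> \<alpha>" and "\<alpha> \<in> cover n"
  shows "\<exists>i\<ge>n. \<alpha> \<le> real_of_rat (a i) + real_of_rat (pay n i)"
proof -
  obtain k where k: "real_of_rat (l n k) < \<alpha>" "\<alpha> < real_of_rat (u n k)"
    using assms(2) by auto
  have a_le: "real_of_rat (a i) \<le> \<alpha>" for i
    using incseq_a lim by (intro incseq_le) (auto simp: incseq_def of_rat_less_eq)
  then have a_less: "a i < u n k" for i
    using k(2) by (metis le_less_trans of_rat_less)
  obtain I0 where I0: "\<And>i. i \<ge> I0 \<Longrightarrow> l n k < a i"
    using order_tendstoD(1)[OF lim k(1)] by (auto simp: eventually_sequentially of_rat_less)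
  \<comment> \<open>From \<open>I\<close> on, \<open>a i\<close> has passed the left end, interval
    \<open>k\<close> has been enumerated, and level \<open>n\<close> may pay.\<close>
  define I where "I = max I0 (max n k)"
  have best: "best n i \<le> i" if "i \<ge> I" for i
    using that I0 a_less by (intro best_le[of k]) (auto simp: I_def)
  show ?thesis
  proof (cases "\<exists>i\<ge>I. reach n (Suc i) \<noteq> reach n i")
    case True
    then obtain i where i: "i \<ge> I" "reach n (Suc i) \<noteq> reach n i" by blast
    have "u n k \<le> u n (best n i)"
      using i(1) I0 a_less by (intro best_props(3) best) (auto simp: I_def)
    then have "\<alpha> \<le> real_of_rat (u n (best n i))"
      using k(2) by (meson le_less_trans less_imp_le of_rat_less_eq order_less_le_trans)
    then show ?thesis
      using reach_change(1,4)[OF i(2)] by (auto simp: of_rat_diff)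
  next
    case False
    have const: "reach n (I + j) = reach n I" for j
      by (induction j) (use False in \<open>auto simp del: reach.simps\<close>)
    define c where "c = reach n I"
    have c: "reach n i = c" if "i \<ge> I" for i
      using const[of "i - I"] that by (simp add: c_def)
    \<comment> \<open>Otherwise stage \<open>i\<close> would choose a new right end beyond
      \<open>a i\<close>; constancy makes it equal to the old one, a contradiction.\<close>
    have below: "c \<noteq> 0 \<and> a i < u n (c - 1)" if "i \<ge> I" for i
    proof (rule ccontr)
      assume "\<not> (c \<noteq> 0 \<and> a i < u n (c - 1))"
      then have "c = Suc (best n i)" "\<not> a i < u n (c - 1) \<or> c = 0"
        using best[OF that] c[OF that] c[of "Suc i"] that by (auto simp: I_def split: if_splits)
      then show False using best_props(2)[OF best[OF that]] by auto
    qed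
    have "\<alpha> \<le> real_of_rat (u n (c - 1))"
      using below by (intro LIMSEQ_le_const2[OF lim]) (auto simp: of_rat_less_eq intro: less_imp_le)
    \<comment> \<open>The stage that set \<open>c\<close> may precede \<open>I\<close>, but as a
      paying stage it is still at least \<open>n\<close>. It exists because \<open>reach\<close>
      starts at 0 and \<open>c\<close> is nonzero.\<close>
    moreover obtain j where j: "reach n (Suc j) \<noteq> reach n j" "reach n (Suc j) = c"
    proof -
      define m where "m = (LEAST m. reach n m = c)"
      have m: "reach n m = c" unfolding m_def by (rule LeastI[of _ I]) (simp add: c_def)
      then have "m \<noteq> 0" using below[of I] by (cases m) auto
      then obtain j where "m = Suc j" by (cases m) auto
      moreover from this have "reach n j \<noteq> c" using not_less_Least[of j "\<lambda>m. reach n m = c"] by (simp add: m_def)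
      ultimately show thesis using that m by metis
    qed
    ultimately show ?thesis
      using reach_change(1,3,4)[OF j(1)] by (auto simp: of_rat_diff)
  qed
qed

text \<open>Level \<open>n\<close> pays only from stage \<open>n\<close> on, so using all levels
  gives arbitrarily late stages.\<close>

lemma infinite_payment_reaches:
  assumes "(\<lambda>i. real_of_rat (a i)) \<longlonglongrightarrow> \<alpha>" and "\<And>n. \<alpha> \<in> cover n"
  shows "infinite {i. \<alpha> \<le> real_of_rat (a i) + real_of_rat (payment i)}"
  unfolding infinite_nat_iff_unbounded_le
proof
  fix n
  obtain i where i: "i \<ge> n" "\<alpha> \<le> real_of_rat (a i) + real_of_rat (pay n i)"
    using pay_reaches[OF assms] by blast
  then have "real_of_rat (pay n i) \<le> real_of_rat (payment i)"
    by (simp add: of_rat_less_eq pay_le_payment)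
  with i show "\<exists>i\<ge>n. i \<in> {i. \<alpha> \<le> real_of_rat (a i) + real_of_rat (payment i)}"
    by (intro exI[of _ i]) auto
qed

lemma computable_payment:
  assumes a: "computable_rat_seq a" and l: "computable_rat_seq2 l" and u: "computable_rat_seq2 u"
  shows "computable_rat_seq payment"
proof -
  note comps = computable_intros a[THEN computable_rat_seq_comp] l[THEN computable_rat_seq2_comp]
    u[THEN computable_rat_seq2_comp]
  have "computable_fun 2 (\<lambda>xs. best (xs ! 0) (xs ! 1))"
    unfolding best_def by (intro comps) auto
  note best = computable_fun_comp2[of best, OF this]
  have reach: "reach n i = rec_nat 0 (\<lambda>i y. if i < n \<or> i < best n i \<or> (y \<noteq> 0 \<and> a i < u n (y - 1))
     then y else Suc (best n i)) i" for n i
    by (induction i) auto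
  have "computable_fun 2 (\<lambda>xs. reach (xs ! 0) (xs ! 1))"
    unfolding reach by (intro comps best computable_fun_rec_nat) auto
  note reach = computable_fun_comp2[of reach, OF this]
  have "computable_rat_seq2 pay"
    unfolding computable_rat_seq2_def pay_def
    by (intro comps reach) auto
  note pay = computable_rat_seq2_comp[OF this]
  \<comment> \<open>\<open>ex_max_pay\<close> ensures that the search for a maximal level
    terminates.\<close>
  show ?thesis
    unfolding computable_rat_seq_def payment_def
    by (intro comps pay ex_max_pay) auto
qed

end

section \<open>From a summable majorant to a test\<close>

text \<open>The integer part of the square root, which recovers \<open>i\<close> from the pair code
  \<open>i * i + j\<close> with \<open>j \<le> i\<close>.\<close>

definition square_root :: "nat \<Rightarrow> nat" where
  "square_root k = (LEAST i. k < Suc i * Suc i)"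

lemma square_root_add:
  assumes "j \<le> i" shows "square_root (i * i + j) = i"
  unfolding square_root_def
proof (rule Least_equality)
  show "i * i + j < Suc i * Suc i" using assms by simp
  fix m assume m: "i * i + j < Suc m * Suc m"
  show "i \<le> m"
  proof (rule ccontr)
    assume "\<not> i \<le> m"
    then have "Suc m * Suc m \<le> i * i" by (intro mult_le_mono) auto
    with m show False by simp
  qed
qed

lemma computable_square_root: "computable_fun k f \<Longrightarrow> computable_fun k (\<lambda>xs. square_root (f xs))"
proof (rule computable_fun_comp1[of square_root])
  have "k < Suc k * Suc k" for k by simp
  then have "\<exists>n. k < Suc n * Suc n" for k by blast
  then show "computable_fun 1 (\<lambda>xs. square_root (xs ! 0))"
    unfolding square_root_def by (intro computable_intros) auto
qed

text \<open>An effective Borel-Cantelli lemma. Monotone left ends allow the points of high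
  multiplicity to be enumerated as intervals with one left end \<open>L i\<close> and one right end
  \<open>R j\<close>.\<close>

lemma not_martin_loef_random_if_infinitely_often:
  fixes L R :: "nat \<Rightarrow> rat"
  assumes comp: "computable_rat_seq L" "computable_rat_seq R"
    and mono: "incseq L" and le: "\<And>i. L i \<le> R i"
    and sum: "summable (\<lambda>i. real_of_rat (R i - L i))"
    and inf: "infinite {i. real_of_rat (L i) < x \<and> x < real_of_rat (R i)}"
  shows "\<not> martin_loef_random x"
proof -
  let ?I = "\<lambda>m. {real_of_rat (L m) <..< real_of_rat (R m)}"
  \<comment> \<open>The sum need not be computable; any fixed power of 2 above it serves as a
    constant of the test.\<close>
  obtain c where c: "(\<Sum>i. real_of_rat (R i - L i)) \<le> 2 ^ c"
    using real_arch_pow[of 2 "\<Sum>i. real_of_rat (R i - L i)"] by (auto intro: less_imp_le)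
  \<comment> \<open>By monotonicity of \<open>L\<close>, each counted interval contains the one from
    \<open>L i\<close> to \<open>R j\<close>.\<close>
  define cnt where "cnt i j = card {m. m < Suc i \<and> R j \<le> R m}" for i j
  \<comment> \<open>With too few counted intervals, the right end \<open>L i\<close> makes the
    enumerated interval empty. Codes that give \<open>j > i\<close> are harmless, since the count is
    still checked.\<close>
  define u where "u n k = (let i = square_root k; j = k - i * i in
    if 2 ^ (n + c) \<le> cnt i j then R j else L i)" for n k
  define l where "l n k = L (square_root k)" for n k :: nat
  define V where "V n = (\<Union>k. {real_of_rat (l n k) <..< real_of_rat (u n k)})" for n
  note comps = computable_intros comp[THEN computable_rat_seq_comp] computable_square_root
  have "computable_rat_seq2 l"
    unfolding computable_rat_seq2_def l_def by (intro comps) auto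
  moreover have "computable_rat_seq2 u"
    unfolding computable_rat_seq2_def u_def Let_def cnt_def by (intro comps) auto
  ultimately have open_V: "uniformly_effectively_open V"
    unfolding uniformly_effectively_open_def V_def by blast
  have V_sets: "V n \<in> sets lborel" for n
    unfolding V_def by auto
  have sum_I: "(\<Sum>m. emeasure lborel (?I m)) \<le> ennreal (2 ^ c)"
  proof -
    have "(\<Sum>m. emeasure lborel (?I m)) = (\<Sum>m. ennreal (real_of_rat (R m - L m)))"
      using le by (intro suminf_cong) (simp add: of_rat_less_eq of_rat_diff)
    also have "\<dots> = ennreal (\<Sum>m. real_of_rat (R m - L m))"
      using le sum by (intro suminf_ennreal2) (auto simp: zero_le_of_rat_iff)
    also have "\<dots> \<le> ennreal (2 ^ c)" using c by (rule ennreal_leI)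
    finally show ?thesis .
  qed
  \<comment> \<open>The pointwise inequality behind Markov's inequality, integrated below.\<close>
  have many: "(2::ennreal) ^ (n + c) * indicator (V n) y \<le> (\<Sum>m. indicator (?I m) y)" for n y
  proof (cases "y \<in> V n")
    case True
    then obtain k where k: "real_of_rat (l n k) < y" "y < real_of_rat (u n k)"
      by (auto simp: V_def)
    define i where "i = square_root k"
    define j where "j = k - i * i"
    have card: "2 ^ (n + c) \<le> cnt i j" and y: "real_of_rat (L i) < y" "y < real_of_rat (R j)"
      using k unfolding l_def u_def Let_def i_def[symmetric] j_def[symmetric]
      by (auto split: if_splits)
    let ?F = "{m. m < Suc i \<and> R j \<le> R m}"
    have in_I: "y \<in> ?I m" if "m \<in> ?F" for m
    proof -
      have "real_of_rat (L m) \<le> real_of_rat (L i)" "real_of_rat (R j) \<le> real_of_rat (R m)"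
        using that incseqD[OF mono, of m i] by (auto simp: of_rat_less_eq)
      with y show ?thesis by auto
    qed
    have "(2::ennreal) ^ (n + c) = of_nat (2 ^ (n + c))" by simp
    also have "\<dots> \<le> of_nat (card ?F)"
      using card unfolding cnt_def by (rule of_nat_mono)
    also have "\<dots> = (\<Sum>m\<in>?F. indicator (?I m) y)"
      using in_I by simp
    also have "\<dots> \<le> (\<Sum>m. indicator (?I m) y)"
      by (intro sum_le_suminf) auto
    finally show ?thesis using True by simp
  qed simp
  have "emeasure lborel (V n) \<le> ennreal ((1 / 2) ^ n)" for n
  proof -
    have "2 ^ (n + c) * emeasure lborel (V n) = (\<integral>\<^sup>+ y. 2 ^ (n + c) * indicator (V n) y \<partial>lborel)"
      by (rule nn_integral_cmult_indicator[OF V_sets, symmetric])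
    also have "\<dots> \<le> (\<integral>\<^sup>+ y. (\<Sum>m. indicator (?I m) y) \<partial>lborel)"
      by (intro nn_integral_mono many)
    also have "\<dots> = (\<Sum>m. emeasure lborel (?I m))"
      by (subst nn_integral_suminf) auto
    also have "\<dots> \<le> ennreal (2 ^ c)" by (rule sum_I)
    finally have *: "2 ^ (n + c) * emeasure lborel (V n) \<le> ennreal (2 ^ c)" .
    \<comment> \<open>Division by \<open>2 ^ (n + c)\<close> is carried out as multiplication by its
      inverse.\<close>
    have "emeasure lborel (V n) = ennreal ((1 / 2) ^ (n + c)) * (2 ^ (n + c) * emeasure lborel (V n))"
    proof -
      have "ennreal ((1 / 2) ^ (n + c)) * 2 ^ (n + c) = ennreal ((1 / 2) ^ (n + c) * 2 ^ (n + c))"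
        by (simp add: ennreal_mult' ennreal_power flip: ennreal_numeral)
      also have "\<dots> = 1" by (simp flip: power_mult_distrib)
      finally show ?thesis by (simp flip: mult.assoc)
    qed
    also have "\<dots> \<le> ennreal ((1 / 2) ^ (n + c)) * ennreal (2 ^ c)"
      using * by (rule mult_left_mono) simp
    also have "\<dots> = ennreal ((1 / 2) ^ n * ((1 / 2) ^ c * 2 ^ c))"
      by (simp add: power_add mult.assoc flip: ennreal_mult')
    also have "\<dots> = ennreal ((1 / 2) ^ n)" by (simp flip: power_mult_distrib)
    finally show ?thesis .
  qed
  with open_V have "martin_loef_test V" by (simp add: martin_loef_test_def)
  moreover have "x \<in> V n" for n
  proof -
    \<comment> \<open>Enough intervals around \<open>x\<close> are chosen; the largest index
      \<open>i\<close> gives their greatest left end, and \<open>j\<close> gives their smallest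
      right end.\<close>
    obtain F where F: "finite F" "card F = 2 ^ (n + c)"
      "F \<subseteq> {i. real_of_rat (L i) < x \<and> x < real_of_rat (R i)}"
      using infinite_arbitrarily_large[OF inf] by blast
    have ne: "F \<noteq> {}" using F(2) by auto
    define i where "i = Max F"
    have i: "i \<in> F" using F(1) ne by (simp add: i_def)
    have "Min (R ` F) \<in> R ` F" using F(1) ne by (intro Min_in) auto
    then obtain j where j: "j \<in> F" "R j = Min (R ` F)" by auto
    have "F \<subseteq> {m. m < Suc i \<and> R j \<le> R m}"
      using F(1) unfolding i_def j(2) by (auto simp: less_Suc_eq_le)
    then have "2 ^ (n + c) \<le> cnt i j"
      unfolding cnt_def F(2)[symmetric] by (intro card_mono) auto
    moreover have "j \<le> i" using j(1) F(1) by (simp add: i_def)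
    ultimately have "l n (i * i + j) = L i" "u n (i * i + j) = R j"
      by (auto simp: l_def u_def square_root_add)
    then have "x \<in> {real_of_rat (l n (i * i + j)) <..< real_of_rat (u n (i * i + j))}"
      using i j(1) F(3) by auto
    then show ?thesis unfolding V_def by blast
  qed
  ultimately show ?thesis unfolding martin_loef_random_def by blast
qed

theorem theorem6:
  fixes a :: "nat \<Rightarrow> rat" and \<alpha> :: real
  assumes "computable_rat_seq a"
    and "incseq a"
    and "(\<lambda>i. real_of_rat (a i)) \<longlonglongrightarrow> \<alpha>"
  shows "\<not> martin_loef_random \<alpha> \<longleftrightarrow>
    (\<exists>h :: nat \<Rightarrow> rat. computable_rat_seq h \<and> (\<forall>i. 0 \<le> h i) \<and>
      summable (\<lambda>i. real_of_rat (h i)) \<and>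
      infinite {i. \<alpha> \<le> real_of_rat (a i) + real_of_rat (h i)})"
    (is "?nonrandom \<longleftrightarrow> ?majorant")
proof
  assume ?nonrandom
  then obtain U where U: "martin_loef_test U" and \<alpha>: "\<And>n. \<alpha> \<in> U n"
    unfolding martin_loef_random_def by auto
  then obtain l u where lu: "computable_rat_seq2 l" "computable_rat_seq2 u"
    and U_eq: "\<And>n. U n = (\<Union>k. {real_of_rat (l n k) <..< real_of_rat (u n k)})"
    unfolding martin_loef_test_def uniformly_effectively_open_def by blast
  interpret interval_family a l u
    by unfold_locales (fact assms(2))
  show ?majorant
  proof (intro exI[of _ payment] conjI allI)
    show "computable_rat_seq payment" using assms(1) lu by (rule computable_payment)
    show "0 \<le> payment i" for i by (rule payment_nonneg)
    show "summable (\<lambda>i. real_of_rat (payment i))"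
      using U by (intro summable_payment) (simp add: martin_loef_test_def flip: U_eq)
    show "infinite {i. \<alpha> \<le> real_of_rat (a i) + real_of_rat (payment i)}"
      using \<alpha> by (intro infinite_payment_reaches assms(3)) (simp flip: U_eq)
  qed
next
  assume ?majorant
  then obtain h where h: "computable_rat_seq h" "\<And>i. 0 \<le> h i"
    "summable (\<lambda>i. real_of_rat (h i))" "infinite {i. \<alpha> \<le> real_of_rat (a i) + real_of_rat (h i)}"
    by blast
  \<comment> \<open>The summable margin \<open>(1 / 2) ^ i\<close> makes both inequalities strict,
    as \<alpha> may equal \<open>a i\<close> or \<open>a i + h i\<close>; since it decreases,
    \<open>L\<close> stays increasing.\<close>
  define L where "L i = a i - (1 / 2) ^ i" for i
  define R where "R i = a i + h i + (1 / 2) ^ i" for i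
  have a_le: "real_of_rat (a i) \<le> \<alpha>" for i
    using assms(2,3) by (intro incseq_le) (auto simp: incseq_def of_rat_less_eq)
  note comps = computable_intros assms(1)[THEN computable_rat_seq_comp] h(1)[THEN computable_rat_seq_comp]
  show ?nonrandom
  proof (rule not_martin_loef_random_if_infinitely_often)
    show "computable_rat_seq L" "computable_rat_seq R"
      unfolding computable_rat_seq_def L_def R_def by (intro comps; simp)+
    show "incseq L"
      unfolding L_def by (intro monoI diff_mono incseqD[OF assms(2)] power_decreasing) auto
    show "L i \<le> R i" for i
      using h(2)[of i] zero_le_power[of "1 / 2 :: rat" i] unfolding L_def R_def by linarith
    have "summable (\<lambda>i. real_of_rat (h i) + 2 * (1 / 2) ^ i)"
      by (intro summable_add summable_mult h(3) summable_geometric) auto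
    then show "summable (\<lambda>i. real_of_rat (R i - L i))"
      by (simp add: L_def R_def of_rat_add of_rat_diff of_rat_mult of_rat_power of_rat_divide algebra_simps)
    have "real_of_rat (L i) < \<alpha> \<and> \<alpha> < real_of_rat (R i)"
      if "\<alpha> \<le> real_of_rat (a i) + real_of_rat (h i)" for i
    proof -
      have "0 < real_of_rat ((1 / 2) ^ i)" by (simp add: zero_less_of_rat_iff)
      with that a_le[of i] show ?thesis
        unfolding L_def R_def of_rat_add of_rat_diff by linarith
    qed
    then show "infinite {i. real_of_rat (L i) < \<alpha> \<and> \<alpha> < real_of_rat (R i)}"
      using h(4) by (elim contrapos_nn finite_subset[rotated]) auto
  qed
qed

end
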